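(* (i) For a constant $0<p<1$, with high probability $\mathrm{dmg}(G(n,p))=n-(1+o(1))pn$. (ii) If $p=p(n)$ satisfies $\dfrac{\log^{2/5}n}{n^{1/5}}\ll p(n)\ll 1$, then with high probability $\mathrm{dmg}(G(n,p))=n-\Theta(np)$.
   Context: $G(n,p)$ is the Erdős–Rényi random graph on $n$ labeled vertices, each pair of vertices being an edge with probability $p$ independently of all other pairs. A sequence of events $\mathcal{E}_n$ holds with high probability if $\mathbb{P}(\mathcal{E}_n)\to 1$ as $n\to\infty$. Asymptotic notation is with respect to $n\to\infty$; $a(n)\ll b(n)$ means $a(n)/b(n)\to 0$. Thus (i) says that for every $\varepsilon>0$, with high probability $(1-\varepsilon)pn\le n-\mathrm{dmg}(G(n,p))\le(1+\varepsilon)pn$; and (ii) says that there are constants $0<c<C$ such that with high probability $c\,np\le n-\mathrm{dmg}(G(n,p))\le C\,np$. Damage number. One cop and one robber play on a graph $G$ with perfect information. First the cop chooses a starting vertex, then the robber chooses a starting vertex (this placement is round $0$). Each subsequent round consists of a move of the cop followed by a move of the robber; in a move a player either stays at the current vertex or moves to a neighboring vertex. If the cop ever occupies the same vertex as the robber, the robber is captured and the game ends. If a vertex $v$ is occupied by the robber at the end of a round and the robber is not caught in the following round, then $v$ becomes damaged and stays damaged for the rest of the game. The cop wants to minimize, and the robber to maximize, the number of damaged vertices. The damage number $\mathrm{dmg}(G)$ is the number of damaged vertices when both play optimally, i.e. the maximum number of vertices the robber can guarantee to damage no matter the strategy of the cop. *)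

theory Defs
  imports "HOL-Probability.Probability" "HOL-Library.Landau_Symbols"
begin

text \<open>A simple graph is given by a vertex set \<open>V\<close> and a set \<open>E\<close> of two-element subsets of \<open>V\<close>.\<close>

definition all_pairs :: "nat \<Rightarrow> nat set set" where
  "all_pairs n = {e. e \<subseteq> {..<n} \<and> card e = 2}"

definition gnp :: "nat \<Rightarrow> real \<Rightarrow> nat set set pmf" where
  "gnp n p = map_pmf (\<lambda>f. {e \<in> all_pairs n. f e})
               (Pi_pmf (all_pairs n) False (\<lambda>_. bernoulli_pmf p))"

definition whp :: "(nat \<Rightarrow> 'a pmf) \<Rightarrow> (nat \<Rightarrow> 'a \<Rightarrow> bool) \<Rightarrow> bool" where
  "whp M P \<longleftrightarrow> (\<lambda>n. measure_pmf.prob (M n) {x. P n x}) \<longlonglongrightarrow> 1"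

text \<open>A history lists the pairs (position of the cop, position of the robber) at the end of the
  rounds played so far, starting with round 0. The cop sees the history; the robber sees the
  history and the vertex the cop has just moved to. The empty history is the placement round.\<close>

type_synonym 'a history = "('a \<times> 'a) list"
type_synonym 'a cop_strategy = "'a history \<Rightarrow> 'a"
type_synonym 'a robber_strategy = "'a history \<Rightarrow> 'a \<Rightarrow> 'a"

definition legal_move :: "'a set \<Rightarrow> 'a set set \<Rightarrow> 'a \<Rightarrow> 'a \<Rightarrow> bool" where
  "legal_move V E u v \<longleftrightarrow> v \<in> V \<and> (v = u \<or> {u, v} \<in> E)"

definition legal_cop :: "'a set \<Rightarrow> 'a set set \<Rightarrow> 'a cop_strategy \<Rightarrow> bool" where
  "legal_cop V E S \<longleftrightarrow>
     S [] \<in> V \<and>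
     (\<forall>h. h \<noteq> [] \<and> set h \<subseteq> V \<times> V \<longrightarrow> legal_move V E (fst (last h)) (S h))"

definition legal_robber :: "'a set \<Rightarrow> 'a set set \<Rightarrow> 'a robber_strategy \<Rightarrow> bool" where
  "legal_robber V E R \<longleftrightarrow>
     (\<forall>c\<in>V. R [] c \<in> V) \<and>
     (\<forall>h. \<forall>c\<in>V. h \<noteq> [] \<and> set h \<subseteq> V \<times> V \<longrightarrow> legal_move V E (snd (last h)) (R h c))"

text \<open>The play is continued formally after a capture; \<open>damaged\<close> below ignores
  everything that happens from the round of the capture on.\<close>

primrec play :: "'a cop_strategy \<Rightarrow> 'a robber_strategy \<Rightarrow> nat \<Rightarrow> 'a history" where
  "play S R 0 = []"
| "play S R (Suc t) =
     play S R t @ [(S (play S R t), R (play S R t) (S (play S R t)))]"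

definition cop_at :: "'a cop_strategy \<Rightarrow> 'a robber_strategy \<Rightarrow> nat \<Rightarrow> 'a" where
  "cop_at S R t = fst (last (play S R (Suc t)))"

definition robber_at :: "'a cop_strategy \<Rightarrow> 'a robber_strategy \<Rightarrow> nat \<Rightarrow> 'a" where
  "robber_at S R t = snd (last (play S R (Suc t)))"

text \<open>The players meet in round \<open>t\<close> either after the cop's move, when the robber is still at his
  position from round \<open>t - 1\<close>, or after the robber's move.\<close>

definition caught :: "'a cop_strategy \<Rightarrow> 'a robber_strategy \<Rightarrow> nat \<Rightarrow> bool" where
  "caught S R t \<longleftrightarrow>
     (t > 0 \<and> cop_at S R t = robber_at S R (t - 1)) \<or> cop_at S R t = robber_at S R t"

definition damaged :: "'a cop_strategy \<Rightarrow> 'a robber_strategy \<Rightarrow> 'a set" where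
  "damaged S R = {v. \<exists>t. robber_at S R t = v \<and> (\<forall>s \<le> Suc t. \<not> caught S R s)}"

definition dmg :: "'a set \<Rightarrow> 'a set set \<Rightarrow> nat" where
  "dmg V E = Max {k. \<exists>R. legal_robber V E R \<and>
                       (\<forall>S. legal_cop V E S \<longrightarrow> k \<le> card (damaged S R))}"

lemma play_in:
  assumes "legal_cop V E S" "legal_robber V E R"
  shows "set (play S R t) \<subseteq> V \<times> V"
proof (induction t)
  case 0 show ?case by simp
next
  case (Suc t)
  have c: "S (play S R t) \<in> V"
    using assms(1) Suc by (cases "play S R t = []") (auto simp: legal_cop_def legal_move_def)
  have "R (play S R t) (S (play S R t)) \<in> V"
    using assms(2) Suc c by (cases "play S R t = []") (auto simp: legal_robber_def legal_move_def)
  with c Suc show ?case by simp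
qed

lemma damaged_subset:
  assumes "legal_cop V E S" "legal_robber V E R"
  shows "damaged S R \<subseteq> V"
proof -
  have "robber_at S R t \<in> V" for t
    using play_in[OF assms, of "Suc t"] by (simp add: robber_at_def)
  then show ?thesis by (auto simp: damaged_def)
qed

text \<open>The maximum in \<open>dmg\<close> is over a finite nonempty set.\<close>

lemma dmg_set:
  fixes V :: "'a set" and E :: "'a set set"
  assumes "finite V" "V \<noteq> {}"
  defines "K \<equiv> {k. \<exists>R. legal_robber V E R \<and> (\<forall>S. legal_cop V E S \<longrightarrow> k \<le> card (damaged S R))}"
  shows "finite K" "K \<noteq> {}" "K \<subseteq> {..card V}"
proof -
  obtain v where v: "v \<in> V" using assms by auto
  let ?S = "\<lambda>h::'a history. if h = [] then v else fst (last h)"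
  let ?R = "\<lambda>(h::'a history) (c::'a). if h = [] then v else snd (last h)"
  have l: "fst (last h) \<in> V \<and> snd (last h) \<in> V" if "h \<noteq> []" "set h \<subseteq> V \<times> V" for h :: "'a history"
    using subsetD[OF that(2) last_in_set[OF that(1)]] by (simp add: mem_Times_iff)
  have S: "legal_cop V E ?S" using v l by (auto simp: legal_cop_def legal_move_def)
  have R: "legal_robber V E ?R" using v l by (auto simp: legal_robber_def legal_move_def)
  show sub: "K \<subseteq> {..card V}"
  proof
    fix k assume "k \<in> K"
    then obtain R' where "legal_robber V E R'" "k \<le> card (damaged ?S R')"
      using S unfolding K_def by blast
    then show "k \<in> {..card V}"
      using damaged_subset[OF S] card_mono[OF assms(1)] by (meson atMost_iff order_trans)
  qed
  then show "finite K" using finite_subset by blast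
  have "0 \<in> K" using R unfolding K_def by blast
  then show "K \<noteq> {}" by blast
qed

end

theory Submission
  imports Defs "HOL-Real_Asymp.Real_Asymp"
begin

text \<open>Write \<open>N\<close> for neighbourhoods. The claim is that in a sufficiently dense random graph the cop can
protect essentially one neighbourhood, of about \<open>n p\<close> vertices, and nothing more.

Protecting one neighbourhood is easy: the cop waits at a vertex \<open>v\<close> and captures the robber as soon
as he enters \<open>N v\<close> (\<open>dmg_le_card_minus_degree\<close>). As degrees are concentrated around \<open>n p\<close>, this
gives the lower bound on \<open>n - dmg\<close>.

For the upper bound, let \<open>U\<close> be the set of vertices not yet visited, and suppose that
\<open>card U \<ge> (1 + \<epsilon>) n p\<close>. A typical vertex \<open>r\<close> has about \<open>p * card U \<ge> (1 + \<epsilon>) n p\<^sup>2\<close> neighbours in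
\<open>U\<close>. A cop at \<open>c \<noteq> r\<close> guards only those in \<open>N r \<inter> N c\<close> (and \<open>c\<close> itself), and all codegrees are
close to \<open>n p\<^sup>2\<close>. So from a typical vertex the robber can enter \<open>U\<close> out of reach of the cop, wherever
the cop moves. The atypical ("poor") vertices depend on \<open>U\<close>, but a union bound over all pairs of
sets shows that, simultaneously for all large \<open>U\<close>, there are at most about \<open>\<delta> n p\<close> of them
(\<open>gnp_no_sparse_pair\<close>). A robber at \<open>r\<close> has about \<open>n p\<close> neighbours, of which about \<open>n p\<^sup>2\<close> are
guarded and at most \<open>\<delta> n p\<close> are poor; since \<open>p\<close> is bounded away from \<open>1\<close>, he can always move to an
unguarded vertex that is not poor, and visit a new vertex in the following round. He is never
captured, so he damages everything he visits, and he goes on until fewer than about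
\<open>(1 + \<epsilon>) n p\<close> vertices are left (\<open>evasion_graph.card_le_dmg_add\<close>).

All the probability estimates follow from Hoeffding's inequality. The most demanding one is for the
codegrees, where a deviation \<open>\<delta> n p\<^sup>2\<close> of a sum of about \<open>n\<close> indicators has probability at
most about \<open>exp (- 2 \<delta>\<^sup>2 n p\<^sup>4)\<close>; this is why \<open>n p\<^sup>4\<close> is compared with \<open>ln n\<close>
(\<open>gnp_dmg_concentration\<close>). Both ranges of \<open>p\<close> in the theorem make \<open>n p\<^sup>4 / ln n\<close> tend to infinity.\<close>

section \<open>Neighbourhoods and plays\<close>

definition nbrs :: "'a set \<Rightarrow> 'a set set \<Rightarrow> 'a \<Rightarrow> 'a set" where
  "nbrs V E v = {u \<in> V. {v, u} \<in> E}"

lemma nbrs_subset: "nbrs V E v \<subseteq> V"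
  by (auto simp: nbrs_def)

lemma play_last:
  "last (play S R (Suc t)) = (cop_at S R t, robber_at S R t)"
  by (simp add: cop_at_def robber_at_def)

lemma cop_at_0: "cop_at S R 0 = S []"
  and robber_at_0: "robber_at S R 0 = R [] (S [])"
  by (simp_all add: cop_at_def robber_at_def)

lemma cop_at_Suc: "cop_at S R (Suc t) = S (play S R (Suc t))"
  and robber_at_Suc: "robber_at S R (Suc t) = R (play S R (Suc t)) (cop_at S R (Suc t))"
  by (simp_all add: cop_at_def robber_at_def)

lemma robbers_of_play: "snd ` set (play S R t) = robber_at S R ` {..<t}"
proof (induction t)
  case (Suc t)
  have "snd ` set (play S R (Suc t)) = insert (robber_at S R t) (snd ` set (play S R t))"
    by (simp add: robber_at_def)
  then show ?case using Suc by (simp add: lessThan_Suc)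
qed simp

section \<open>A waiting cop protects a neighbourhood\<close>

definition ambush :: "'a set set \<Rightarrow> 'a \<Rightarrow> 'a cop_strategy" where
  "ambush E v h = (if h = [] then v
     else if {fst (last h), snd (last h)} \<in> E then snd (last h) else fst (last h))"

text \<open>The cop sits at \<open>v\<close> until the robber stands next to him, and then captures the robber at once.
So a neighbour of \<open>v\<close> is never occupied by the robber for a full round without a capture,
which means that no neighbour of \<open>v\<close> is ever damaged.\<close>

lemma dmg_le_card_minus_degree:
  assumes "finite V" "v \<in> V"
  shows "dmg V E \<le> card V - card (nbrs V E v)"
proof -
  let ?K = "{k. \<exists>R. legal_robber V E R \<and> (\<forall>S. legal_cop V E S \<longrightarrow> k \<le> card (damaged S R))}"
  have ne: "V \<noteq> {}" using assms by auto
  note K = dmg_set[OF assms(1) ne, of E]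
  have cop: "legal_cop V E (ambush E v)"
    unfolding legal_cop_def
  proof (intro conjI allI impI)
    show "ambush E v [] \<in> V" using assms by (simp add: ambush_def)
    fix h :: "'a history" assume h: "h \<noteq> [] \<and> set h \<subseteq> V \<times> V"
    then have "last h \<in> V \<times> V" by (meson last_in_set subsetD)
    then show "legal_move V E (fst (last h)) (ambush E v h)"
      using h by (auto simp: legal_move_def ambush_def)
  qed
  have "dmg V E \<in> ?K" unfolding dmg_def by (rule Max_in[OF K(1,2)])
  then obtain R where R: "legal_robber V E R" "dmg V E \<le> card (damaged (ambush E v) R)"
    using cop by blast
  let ?c = "cop_at (ambush E v) R" and ?r = "robber_at (ambush E v) R"
  let ?caught = "caught (ambush E v) R"
  have next_c: "?c (Suc t) = (if {?c t, ?r t} \<in> E then ?r t else ?c t)" for t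
  proof -
    have "play (ambush E v) R (Suc t) \<noteq> []" by simp
    then show ?thesis
      unfolding cop_at_Suc by (simp only: ambush_def[of _ _ "play (ambush E v) R (Suc t)"] play_last
        fst_conv snd_conv if_False)
  qed
  have waits: "?c s = v" if "\<forall>s' \<le> s. \<not> ?caught s'" for s
    using that
  proof (induction s)
    case 0 show ?case by (simp add: cop_at_0 ambush_def)
  next
    case (Suc s)
    have "?c s = v" using Suc by auto
    moreover have "?c (Suc s) \<noteq> ?r s" using Suc.prems[rule_format, of "Suc s"] by (auto simp: caught_def)
    ultimately show ?case using next_c[of s] by (auto split: if_splits)
  qed
  have "damaged (ambush E v) R \<subseteq> V - nbrs V E v"
  proof
    fix w assume w: "w \<in> damaged (ambush E v) R"
    then obtain t where t: "?r t = w" "\<forall>s \<le> Suc t. \<not> ?caught s" by (auto simp: damaged_def)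
    have "w \<notin> nbrs V E v"
    proof
      assume "w \<in> nbrs V E v"
      then have "?c (Suc t) = ?r t" using next_c[of t] waits[of t] t by (auto simp: nbrs_def)
      then show False using t(2)[rule_format, of "Suc t"] by (auto simp: caught_def)
    qed
    then show "w \<in> V - nbrs V E v" using damaged_subset[OF cop R(1)] w by auto
  qed
  then have "card (damaged (ambush E v) R) \<le> card (V - nbrs V E v)"
    using assms(1) by (intro card_mono) auto
  also have "\<dots> = card V - card (nbrs V E v)"
    using assms(1) nbrs_subset[of V E v] by (intro card_Diff_subset) (auto intro: finite_subset)
  finally show ?thesis using R(2) by linarith
qed

section \<open>An evading robber\<close>

text \<open>The conditions under which the robber can damage all but at most \<open>K\<close> vertices. A vertex
is called poor for a set \<open>U\<close> of still unvisited vertices if it has at most \<open>m\<close> neighbours in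
\<open>U\<close>. Since \<open>m\<close> bounds the number of neighbours of the robber's position that a cop standing
elsewhere can guard, a robber on a vertex that is not poor can always move to an unguarded
vertex of \<open>U\<close>. The degree condition makes more than \<open>m\<close> plus the number of poor vertices
available, so that the robber can always move to an unguarded vertex that is not poor.\<close>

locale evasion_graph =
  fixes V :: "'a set" and E :: "'a set set" and m :: real and b K :: nat
  assumes finite_V: "finite V" and two_vertices: "2 \<le> card V"
    and common_nbrs: "\<And>r c. r \<in> V \<Longrightarrow> c \<in> V \<Longrightarrow> r \<noteq> c \<Longrightarrow>
          real (card (nbrs V E r \<inter> insert c (nbrs V E c))) \<le> m"
    and degree: "\<And>r. r \<in> V \<Longrightarrow> m + real b \<le> real (card (nbrs V E r))"
    and b_pos: "0 < b"
    and few_poor: "\<And>U. U \<subseteq> V \<Longrightarrow> K \<le> card U \<Longrightarrow>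
          card {r \<in> V. real (card (nbrs V E r \<inter> U)) \<le> m} < b"
begin

definition safe :: "'a \<Rightarrow> 'a \<Rightarrow> 'a set" where
  "safe r c = nbrs V E r - insert c (nbrs V E c)"

text \<open>For small \<open>U\<close> no vertex counts as poor: \<open>few_poor\<close> gives no information on such sets, but the
robber still has to keep escaping after most vertices have been visited.\<close>

definition poor :: "'a set \<Rightarrow> 'a set" where
  "poor U = {r \<in> V. K \<le> card U \<and> real (card (nbrs V E r \<inter> U)) \<le> m}"

definition fresh :: "'a history \<Rightarrow> 'a set" where
  "fresh h = V - snd ` set h"

text \<open>The robber prefers an unguarded unvisited vertex, and otherwise takes an unguarded vertex that
is not poor for the unvisited set. Staying put is the default that keeps the strategy legal when
there is no such vertex, for instance after a capture: \<open>safe r r\<close> is empty.\<close>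

definition evader :: "'a robber_strategy" where
  "evader h c = (if h = [] then SOME r. r \<in> V - insert c (nbrs V E c)
     else let r = snd (last h) in
       if safe r c \<inter> fresh h \<noteq> {} then SOME u. u \<in> safe r c \<inter> fresh h
       else if safe r c - poor (fresh h) \<noteq> {} then SOME u. u \<in> safe r c - poor (fresh h)
       else r)"

lemma finite_nbrs: "finite (nbrs V E v)"
  using finite_V nbrs_subset by (rule finite_subset[rotated])

lemma card_poor: "U \<subseteq> V \<Longrightarrow> card (poor U) < b"
  using few_poor[of U] b_pos by (cases "K \<le> card U") (auto simp: poor_def)

lemma safe_not_subset_poor:
  assumes "r \<in> V" "c \<in> V" "r \<noteq> c" "U \<subseteq> V"
  shows "safe r c - poor U \<noteq> {}"
proof
  assume "safe r c - poor U = {}"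
  then have "nbrs V E r \<subseteq> (nbrs V E r \<inter> insert c (nbrs V E c)) \<union> poor U"
    by (auto simp: safe_def)
  then have "card (nbrs V E r) \<le> card ((nbrs V E r \<inter> insert c (nbrs V E c)) \<union> poor U)"
    using finite_nbrs finite_V by (intro card_mono) (auto simp: poor_def)
  also have "\<dots> \<le> card (nbrs V E r \<inter> insert c (nbrs V E c)) + card (poor U)"
    by (rule card_Un_le)
  finally show False
    using common_nbrs[OF assms(1-3)] degree[OF assms(1)] card_poor[OF assms(4)] by linarith
qed

lemma safe_meets:
  assumes "r \<in> V" "c \<in> V" "r \<noteq> c" "K \<le> card U" "r \<notin> poor U"
  shows "safe r c \<inter> U \<noteq> {}"
proof
  assume "safe r c \<inter> U = {}"
  then have "nbrs V E r \<inter> U \<subseteq> nbrs V E r \<inter> insert c (nbrs V E c)"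
    by (auto simp: safe_def)
  then have "card (nbrs V E r \<inter> U) \<le> card (nbrs V E r \<inter> insert c (nbrs V E c))"
    using finite_nbrs by (intro card_mono) auto
  then show False
    using common_nbrs[OF assms(1-3)] assms(1,4,5) by (auto simp: poor_def)
qed

lemma evader_start:
  assumes "c \<in> V"
  shows "evader [] c \<in> V - insert c (nbrs V E c)"
proof -
  have "card (insert c (nbrs V E c) \<inter> nbrs V E r) < card (nbrs V E r)" if "r \<in> V" "r \<noteq> c" for r
    using common_nbrs[OF that(1) assms that(2)] degree[OF that(1)] b_pos by (simp add: Int_commute)
  moreover have "\<exists>r\<in>V. r \<noteq> c"
  proof (rule ccontr)
    assume "\<not> (\<exists>r\<in>V. r \<noteq> c)"
    then have "V \<subseteq> {c}" by auto
    then show False using card_mono[of "{c}" V] two_vertices by simp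
  qed
  ultimately have "V - insert c (nbrs V E c) \<noteq> {}"
    using nbrs_subset[of V E] by (metis Diff_eq_empty_iff Int_absorb1 less_irrefl order_trans)
  then show ?thesis unfolding evader_def by (simp only: if_True simp_thms) (metis ex_in_conv someI_ex)
qed

lemma evader_step:
  assumes h: "h \<noteq> []" "snd (last h) = r" and rc: "r \<in> V" "c \<in> V" "r \<noteq> c"
  shows "evader h c \<in> safe r c"
    and "safe r c \<inter> fresh h \<noteq> {} \<Longrightarrow> evader h c \<in> fresh h"
    and "safe r c \<inter> fresh h = {} \<Longrightarrow> evader h c \<notin> poor (fresh h)"
proof -
  have *: "safe r c - poor (fresh h) \<noteq> {}"
    by (rule safe_not_subset_poor) (use rc in \<open>auto simp: fresh_def\<close>)
  have 1: "evader h c \<in> safe r c \<inter> fresh h" if "safe r c \<inter> fresh h \<noteq> {}"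
    using that h some_in_eq[of "safe r c \<inter> fresh h"] by (simp add: evader_def Let_def)
  have 2: "evader h c \<in> safe r c - poor (fresh h)" if "safe r c \<inter> fresh h = {}"
    using that h some_in_eq[of "safe r c - poor (fresh h)"] * by (simp add: evader_def Let_def)
  show "evader h c \<in> safe r c"
    "safe r c \<inter> fresh h \<noteq> {} \<Longrightarrow> evader h c \<in> fresh h"
    "safe r c \<inter> fresh h = {} \<Longrightarrow> evader h c \<notin> poor (fresh h)"
    using 1 2 by blast+
qed

lemma legal_evader: "legal_robber V E evader"
  unfolding legal_robber_def
proof (intro conjI allI ballI impI)
  fix c assume "c \<in> V"
  then show "evader [] c \<in> V" using evader_start by blast
next
  fix h :: "'a history" and c
  assume c: "c \<in> V" and h: "h \<noteq> [] \<and> set h \<subseteq> V \<times> V"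
  then have "last h \<in> V \<times> V" by (meson last_in_set subsetD)
  then have r: "snd (last h) \<in> V" by auto
  have "evader h c \<in> insert (snd (last h)) (safe (snd (last h)) c)"
    using h some_in_eq[of "safe (snd (last h)) c \<inter> fresh h"]
      some_in_eq[of "safe (snd (last h)) c - poor (fresh h)"]
    by (auto simp: evader_def Let_def)
  then show "legal_move V E (snd (last h)) (evader h c)"
    using r by (auto simp: legal_move_def safe_def nbrs_def)
qed

context
  fixes S :: "'a cop_strategy"
  assumes cop: "legal_cop V E S"
begin

abbreviation "c \<equiv> cop_at S evader"
abbreviation "r \<equiv> robber_at S evader"

lemma positions_in_V: "c t \<in> V" "r t \<in> V"
proof -
  have "play S evader (Suc t) \<noteq> []" by simp
  then have "last (play S evader (Suc t)) \<in> V \<times> V"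
    using play_in[OF cop legal_evader, of "Suc t"] last_in_set by blast
  then show "c t \<in> V" "r t \<in> V" unfolding play_last by auto
qed

lemma cop_move: "c (Suc t) = c t \<or> {c t, c (Suc t)} \<in> E"
proof -
  have "play S evader (Suc t) \<noteq> []" by simp
  then have "legal_move V E (fst (last (play S evader (Suc t)))) (c (Suc t))"
    using play_in[OF cop legal_evader, of "Suc t"] cop unfolding cop_at_Suc legal_cop_def by blast
  then show ?thesis unfolding play_last by (auto simp: legal_move_def)
qed

text \<open>Not being adjacent to the cop at the end of a round is all that the robber needs in order to
survive the next move of the cop.\<close>

lemma cop_cannot_capture:
  assumes "r t \<notin> insert (c t) (nbrs V E (c t))"
  shows "r t \<noteq> c (Suc t)"
  using assms cop_move[of t] positions_in_V(2)[of t] by (auto simp: nbrs_def)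

lemma evader_move:
  assumes "r t \<notin> insert (c t) (nbrs V E (c t))"
  defines "h \<equiv> play S evader (Suc t)"
  shows "r (Suc t) \<in> safe (r t) (c (Suc t))"
    and "safe (r t) (c (Suc t)) \<inter> fresh h \<noteq> {} \<Longrightarrow> r (Suc t) \<in> fresh h"
    and "safe (r t) (c (Suc t)) \<inter> fresh h = {} \<Longrightarrow> r (Suc t) \<notin> poor (fresh h)"
proof -
  have h: "h \<noteq> []" "snd (last h) = r t" unfolding h_def play_last by simp_all
  note evader_step[OF h positions_in_V(2) positions_in_V(1) cop_cannot_capture[OF assms(1)]]
  moreover have "r (Suc t) = evader h (c (Suc t))" unfolding h_def by (rule robber_at_Suc)
  ultimately show "r (Suc t) \<in> safe (r t) (c (Suc t))"
    "safe (r t) (c (Suc t)) \<inter> fresh h \<noteq> {} \<Longrightarrow> r (Suc t) \<in> fresh h"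
    "safe (r t) (c (Suc t)) \<inter> fresh h = {} \<Longrightarrow> r (Suc t) \<notin> poor (fresh h)"
    by simp_all
qed

lemma not_adjacent: "r t \<notin> insert (c t) (nbrs V E (c t))"
proof (induction t)
  case 0
  have "S [] \<in> V" using cop by (simp add: legal_cop_def)
  then show ?case using evader_start by (simp add: cop_at_0 robber_at_0)
next
  case (Suc t)
  then show ?case using evader_move(1)[OF Suc] by (auto simp: safe_def)
qed

lemma never_caught: "\<not> caught S evader t"
proof (cases t)
  case 0
  then show ?thesis using not_adjacent[of 0] by (auto simp: caught_def)
next
  case (Suc s)
  then show ?thesis
    using cop_cannot_capture[OF not_adjacent, of s] not_adjacent[of "Suc s"] by (auto simp: caught_def)
qed

text \<open>As there is no capture, visiting a vertex once is enough to damage it.\<close>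

lemma damaged_eq_visited: "damaged S evader = range r"
  using never_caught by (auto simp: damaged_def)

abbreviation "unvisited t \<equiv> V - r ` {..<t}"

lemma fresh_eq_unvisited: "fresh (play S evader t) = unvisited t"
  by (simp only: fresh_def robbers_of_play)

text \<open>If neither of two successive robber moves reached an unvisited vertex, then the first of them
led, by the choice of the strategy, to a vertex that is not poor for the unchanged unvisited set;
but from there an unguarded unvisited vertex was available for the second move.\<close>

lemma progress:
  assumes "K \<le> card (unvisited (Suc t))"
  shows "card (unvisited (Suc (Suc (Suc t)))) < card (unvisited (Suc t))"
proof -
  \<comment> \<open>\<open>unvisited (Suc t)\<close> already excludes the position \<open>r t\<close> at the end of round \<open>t\<close>.\<close>
  have "r (Suc t) \<in> unvisited (Suc t) \<or> r (Suc (Suc t)) \<in> unvisited (Suc t)"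
  proof (rule ccontr)
    assume no: "\<not> ?thesis"
    have "safe (r t) (c (Suc t)) \<inter> unvisited (Suc t) = {}"
      using evader_move(2)[OF not_adjacent, of t] no unfolding fresh_eq_unvisited by blast
    then have np: "r (Suc t) \<notin> poor (unvisited (Suc t))"
      using evader_move(3)[OF not_adjacent, of t] unfolding fresh_eq_unvisited by blast
    have eq: "unvisited (Suc (Suc t)) = unvisited (Suc t)"
      using no by (auto simp: lessThan_Suc)
    have "safe (r (Suc t)) (c (Suc (Suc t))) \<inter> unvisited (Suc t) \<noteq> {}"
      by (rule safe_meets[OF positions_in_V(2) positions_in_V(1) cop_cannot_capture[OF not_adjacent] assms np])
    then show False
      using evader_move(2)[OF not_adjacent, of "Suc t"] no unfolding fresh_eq_unvisited eq by blast
  qed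
  then have "unvisited (Suc (Suc (Suc t))) \<subset> unvisited (Suc t)"
    by (auto simp: lessThan_Suc)
  then show ?thesis using finite_V by (intro psubset_card_mono) auto
qed

lemma eventually_few_unvisited: "\<exists>t. card (unvisited t) < K"
proof (rule ccontr)
  assume "\<nexists>t. card (unvisited t) < K"
  then have big: "K \<le> card (unvisited t)" for t by (auto simp: not_less)
  have "card (unvisited (Suc (2 * k))) + k \<le> card V" for k
  proof (induction k)
    case 0 show ?case using finite_V by (auto intro!: card_mono)
  next
    case (Suc k)
    then show ?case using progress[OF big, of "2 * k"] by simp
  qed
  from this[of "Suc (card V)"] show False by simp
qed

lemma many_damaged: "card V - K \<le> card (damaged S evader)"
proof -
  obtain t where t: "card (unvisited t) < K" using eventually_few_unvisited by blast
  have "card V \<le> card (unvisited t \<union> damaged S evader)"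
    using finite_V damaged_subset[OF cop legal_evader] damaged_eq_visited
    by (intro card_mono) (auto intro: finite_subset)
  also have "\<dots> \<le> card (unvisited t) + card (damaged S evader)" by (rule card_Un_le)
  finally show ?thesis using t by linarith
qed

end

theorem card_le_dmg_add: "card V \<le> dmg V E + K"
proof -
  let ?A = "{k. \<exists>R. legal_robber V E R \<and> (\<forall>S. legal_cop V E S \<longrightarrow> k \<le> card (damaged S R))}"
  have "V \<noteq> {}" using two_vertices by auto
  then have "finite ?A" by (rule dmg_set(1)[OF finite_V])
  moreover have "card V - K \<in> ?A" using legal_evader many_damaged by blast
  ultimately have "card V - K \<le> dmg V E" unfolding dmg_def by (rule Max_ge)
  then show ?thesis by linarith
qed

end

section \<open>Concentration in the binomial random graph\<close>

lemma prob_all_True_Pi_bernoulli: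
  assumes "finite A" "B \<subseteq> A" "0 \<le> p" "p \<le> 1"
  shows "measure_pmf.prob (Pi_pmf A False (\<lambda>_. bernoulli_pmf p)) {f. \<forall>e\<in>B. f e} = p ^ card B"
proof -
  let ?T = "\<lambda>e. if e \<in> B then {True} else UNIV"
  have "{f. \<forall>e\<in>B. f e} = Pi A ?T"
    using assms(2) by (auto simp: Pi_def)
  then have "measure_pmf.prob (Pi_pmf A False (\<lambda>_. bernoulli_pmf p)) {f. \<forall>e\<in>B. f e}
      = (\<Prod>e\<in>A. measure_pmf.prob (bernoulli_pmf p) (?T e))"
    using measure_Pi_pmf_Pi[OF assms(1)] by simp
  also have "\<dots> = (\<Prod>e\<in>A. if e \<in> B then p else 1)"
    using assms by (intro prod.cong) (auto simp: measure_pmf_single)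
  also have "\<dots> = (\<Prod>e\<in>B. p)"
    using assms by (subst prod.inter_restrict[symmetric]) (auto simp: Int_absorb1)
  finally show ?thesis by simp
qed

text \<open>Degrees, codegrees and the numbers of edges between disjoint vertex sets all count how many
blocks of a disjoint family of edge sets are completely present, the blocks having one, two and
one edges, respectively. Disjoint blocks are present independently of each other, so that one
application of Hoeffding's inequality covers all three.\<close>

lemma Hoeffding_disjoint_blocks:
  fixes K :: "'i \<Rightarrow> 'e set"
  assumes "finite A" "finite J" "J \<noteq> {}" "0 \<le> p" "p \<le> 1" "0 \<le> t"
    and KA: "\<And>j. j \<in> J \<Longrightarrow> K j \<subseteq> A" and Kk: "\<And>j. j \<in> J \<Longrightarrow> card (K j) = k"
    and disj: "disjoint_family_on K J"
  defines "M \<equiv> Pi_pmf A False (\<lambda>_. bernoulli_pmf p)"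
    and "X \<equiv> \<lambda>f. real (card {j \<in> J. \<forall>e\<in>K j. f e})"
  shows "measure_pmf.prob M {f. X f \<le> real (card J) * p ^ k - t} \<le> exp (- 2 * t\<^sup>2 / real (card J))"
    and "measure_pmf.prob M {f. X f \<ge> real (card J) * p ^ k + t} \<le> exp (- 2 * t\<^sup>2 / real (card J))"
proof -
  define Y :: "'i \<Rightarrow> ('e \<Rightarrow> bool) \<Rightarrow> real" where "Y j f = (if \<forall>e\<in>K j. f e then 1 else 0)" for j f
  have "prob_space.indep_vars (measure_pmf M) (\<lambda>j. PiM (K j) (\<lambda>_. count_space UNIV))
      (\<lambda>j f. restrict (\<lambda>e. f e) (K j)) J"
    using prob_space.indep_vars_restrict[OF prob_space_measure_pmf indep_vars_Pi_pmf[OF assms(1)] KA disj]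
    unfolding M_def .
  then have "prob_space.indep_vars (measure_pmf M) (\<lambda>_. borel) (\<lambda>j f. Y j (restrict (\<lambda>e. f e) (K j))) J"
  proof (rule prob_space.indep_vars_compose2[OF prob_space_measure_pmf])
    fix j assume j: "j \<in> J"
    have fin: "finite (K j)" using KA[OF j] assms(1) by (rule finite_subset)
    then show "Y j \<in> borel_measurable (PiM (K j) (\<lambda>_. count_space UNIV))"
      unfolding Y_def by measurable
  qed
  then have indep: "prob_space.indep_vars (measure_pmf M) (\<lambda>_. borel) Y J"
    by (simp add: Y_def[abs_def])
  interpret Hoeffding_ineq "measure_pmf M" J Y "\<lambda>_. 0" "\<lambda>_. 1" "\<Sum>j\<in>J. measure_pmf.expectation M (Y j)"
    by unfold_locales (use assms indep in \<open>auto simp: Y_def\<close>)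
  have "measure_pmf.expectation M (Y j) = p ^ k" if "j \<in> J" for j
  proof -
    have "Y j = indicator {f. \<forall>e\<in>K j. f e}" by (auto simp: Y_def indicator_def)
    then show ?thesis
      using prob_all_True_Pi_bernoulli[OF assms(1) KA[OF that] assms(4,5)] Kk[OF that]
      by (simp add: M_def)
  qed
  then have mean: "(\<Sum>j\<in>J. measure_pmf.expectation M (Y j)) = real (card J) * p ^ k" by simp
  have X: "(\<Sum>j\<in>J. Y j f) = X f" for f
    using assms(2) by (simp add: Y_def X_def sum.If_cases Int_def)
  have "0 < real (card J)" using assms(2,3) by (simp add: card_gt_0_iff)
  then show "measure_pmf.prob M {f. X f \<le> real (card J) * p ^ k - t} \<le> exp (- 2 * t\<^sup>2 / real (card J))"
    "measure_pmf.prob M {f. X f \<ge> real (card J) * p ^ k + t} \<le> exp (- 2 * t\<^sup>2 / real (card J))"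
    using Hoeffding_ineq_le[OF assms(6)] Hoeffding_ineq_ge[OF assms(6)]
    unfolding mean X by simp_all
qed

lemma finite_all_pairs: "finite (all_pairs n)"
  by (rule finite_subset[of _ "Pow {..<n}"]) (auto simp: all_pairs_def)

lemma gnp_disjoint_blocks:
  fixes K :: "'i \<Rightarrow> nat set set"
  assumes "finite J" "J \<noteq> {}" "0 \<le> p" "p \<le> 1" "0 \<le> t"
    and KA: "\<And>j. j \<in> J \<Longrightarrow> K j \<subseteq> all_pairs n" and Kk: "\<And>j. j \<in> J \<Longrightarrow> card (K j) = k"
    and disj: "disjoint_family_on K J"
  shows "measure_pmf.prob (gnp n p) {E. real (card {j \<in> J. K j \<subseteq> E}) \<le> real (card J) * p ^ k - t}
           \<le> exp (- 2 * t\<^sup>2 / real (card J))"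
    and "measure_pmf.prob (gnp n p) {E. real (card {j \<in> J. K j \<subseteq> E}) \<ge> real (card J) * p ^ k + t}
           \<le> exp (- 2 * t\<^sup>2 / real (card J))"
proof -
  have "{j \<in> J. K j \<subseteq> {e \<in> all_pairs n. f e}} = {j \<in> J. \<forall>e\<in>K j. f e}" for f
    using KA by blast
  then show "measure_pmf.prob (gnp n p) {E. real (card {j \<in> J. K j \<subseteq> E}) \<le> real (card J) * p ^ k - t}
           \<le> exp (- 2 * t\<^sup>2 / real (card J))"
    "measure_pmf.prob (gnp n p) {E. real (card {j \<in> J. K j \<subseteq> E}) \<ge> real (card J) * p ^ k + t}
           \<le> exp (- 2 * t\<^sup>2 / real (card J))"
    using Hoeffding_disjoint_blocks[OF finite_all_pairs assms(1-5) KA Kk disj]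
    by (simp_all add: gnp_def vimage_def)
qed

lemma gnp_degree_tail:
  assumes "v < n" "2 \<le> n" "0 \<le> p" "p \<le> 1" "0 \<le> t"
  shows "measure_pmf.prob (gnp n p) {E. real (card (nbrs {..<n} E v)) \<le> (real n - 1) * p - t}
           \<le> exp (- 2 * t\<^sup>2 / real n)"
proof -
  let ?J = "{..<n} - {v}" and ?K = "\<lambda>u. {{v, u}}"
  have card_J: "card ?J = n - 1" using assms by simp
  have J: "?J \<noteq> {}"
  proof
    assume "?J = {}"
    then have "card ?J = 0" by (simp only: card.empty)
    then show False using card_J assms(2) by linarith
  qed
  \<comment> \<open>Only an inequality, as \<open>E\<close> is an arbitrary set that might contain the singleton \<open>{v}\<close>.\<close>
  have "card {u \<in> ?J. ?K u \<subseteq> E} \<le> card (nbrs {..<n} E v)" for E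
    by (intro card_mono) (auto simp: nbrs_def)
  then have "measure_pmf.prob (gnp n p) {E. real (card (nbrs {..<n} E v)) \<le> (real n - 1) * p - t}
     \<le> measure_pmf.prob (gnp n p) {E. real (card {u \<in> ?J. ?K u \<subseteq> E}) \<le> real (card ?J) * p ^ 1 - t}"
    using assms(2) unfolding card_J
    by (intro measure_pmf.finite_measure_mono) (auto simp: of_nat_diff intro: order_trans[rotated])
  also have "\<dots> \<le> exp (- 2 * t\<^sup>2 / real (card ?J))"
    by (rule gnp_disjoint_blocks(1))
      (use assms J in \<open>auto simp: all_pairs_def disjoint_family_on_def doubleton_eq_iff\<close>)
  also have "\<dots> \<le> exp (- 2 * t\<^sup>2 / real n)"
    unfolding card_J using assms(2) by (auto intro!: divide_left_mono)
  finally show ?thesis .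
qed

text \<open>The summand \<open>2\<close> accounts for \<open>r\<close> and \<open>c\<close> themselves, which are no part of the independent
family of two-edge paths between \<open>r\<close> and \<open>c\<close>.\<close>

lemma gnp_codegree_tail:
  assumes "r < n" "c < n" "r \<noteq> c" "3 \<le> n" "0 \<le> p" "p \<le> 1" "0 \<le> t"
  shows "measure_pmf.prob (gnp n p)
           {E. real (card (nbrs {..<n} E r \<inter> insert c (nbrs {..<n} E c))) \<ge> real n * p\<^sup>2 + 2 + t}
         \<le> exp (- 2 * t\<^sup>2 / real n)"
proof -
  let ?J = "{..<n} - {r, c}" and ?K = "\<lambda>u. {{r, u}, {c, u}}"
  have card_J: "card ?J = n - 2" using assms by (simp add: card_Diff_subset)
  have J: "?J \<noteq> {}" 
  proof
    assume "?J = {}"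
    then have "card ?J = 0" by (simp only: card.empty)
    then show False using card_J assms(4) by linarith
  qed
  have "card (nbrs {..<n} E r \<inter> insert c (nbrs {..<n} E c)) \<le> card ({u \<in> ?J. ?K u \<subseteq> E} \<union> {r, c})" for E
    by (intro card_mono) (auto simp: nbrs_def)
  moreover have "card ({u \<in> ?J. ?K u \<subseteq> E} \<union> {r, c}) \<le> card {u \<in> ?J. ?K u \<subseteq> E} + 2" for E
    using card_Un_le[of "{u \<in> ?J. ?K u \<subseteq> E}" "{r, c}"] assms(3) by simp
  ultimately have "card (nbrs {..<n} E r \<inter> insert c (nbrs {..<n} E c)) \<le> card {u \<in> ?J. ?K u \<subseteq> E} + 2" for E
    by (rule order_trans)
  then have le: "real (card (nbrs {..<n} E r \<inter> insert c (nbrs {..<n} E c)))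
      \<le> real (card {u \<in> ?J. ?K u \<subseteq> E}) + 2" for E
    by (metis (mono_tags) of_nat_add of_nat_le_iff of_nat_numeral)
  have mean: "real (card ?J) * p\<^sup>2 \<le> real n * p\<^sup>2" unfolding card_J by (intro mult_right_mono) auto
  have "measure_pmf.prob (gnp n p)
           {E. real (card (nbrs {..<n} E r \<inter> insert c (nbrs {..<n} E c))) \<ge> real n * p\<^sup>2 + 2 + t}
     \<le> measure_pmf.prob (gnp n p) {E. real (card {u \<in> ?J. ?K u \<subseteq> E}) \<ge> real (card ?J) * p ^ 2 + t}"
  proof (intro measure_pmf.finite_measure_mono subsetI)
    fix E assume "E \<in> {E. real (card (nbrs {..<n} E r \<inter> insert c (nbrs {..<n} E c))) \<ge> real n * p\<^sup>2 + 2 + t}"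
    then show "E \<in> {E. real (card {u \<in> ?J. ?K u \<subseteq> E}) \<ge> real (card ?J) * p ^ 2 + t}"
      using le[of E] mean unfolding mem_Collect_eq by linarith
  qed simp
  also have "\<dots> \<le> exp (- 2 * t\<^sup>2 / real (card ?J))"
    by (rule gnp_disjoint_blocks(2))
      (use assms J in \<open>auto simp: all_pairs_def disjoint_family_on_def doubleton_eq_iff\<close>)
  also have "\<dots> \<le> exp (- 2 * t\<^sup>2 / real n)"
    unfolding card_J using assms(4) by (auto intro!: divide_left_mono)
  finally show ?thesis .
qed

text \<open>If every vertex of \<open>B\<close> has at most \<open>m\<close> neighbours in \<open>U\<close>, then the number of edges between
\<open>B\<close> and \<open>U\<close> is below its mean by at least \<open>card B * (card U * p - m)\<close>. Bounding the whole set
\<open>B\<close> at once gives a probability small enough to survive the union bound over all \<open>B\<close> and \<open>U\<close>.\<close>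

lemma gnp_sparse_pair_tail:
  assumes "B \<subseteq> {..<n}" "U \<subseteq> {..<n}" "B \<inter> U = {}" "B \<noteq> {}" "U \<noteq> {}" "0 \<le> p" "p \<le> 1"
    and m: "m \<le> real (card U) * p"
  shows "measure_pmf.prob (gnp n p) {E. \<forall>r\<in>B. real (card (nbrs {..<n} E r \<inter> U)) \<le> m}
         \<le> exp (- 2 * real (card B) * (real (card U) * p - m)\<^sup>2 / real (card U))"
proof -
  let ?J = "B \<times> U" and ?K = "\<lambda>(r, u). {{r, u}}"
  define t where "t = real (card B) * (real (card U) * p - m)"
  have fin: "finite B" "finite U" using assms(1,2) by (auto intro: finite_subset)
  have pos: "0 < card B" "0 < card U" using fin assms(4,5) by (auto simp: card_gt_0_iff)
  have "real (card {j \<in> ?J. ?K j \<subseteq> E}) \<le> real (card ?J) * p ^ 1 - t"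
    if "\<forall>r\<in>B. real (card (nbrs {..<n} E r \<inter> U)) \<le> m" for E
  proof -
    have "{j \<in> ?J. ?K j \<subseteq> E} = Sigma B (\<lambda>r. nbrs {..<n} E r \<inter> U)"
      using assms(2) by (auto simp: nbrs_def)
    then have "real (card {j \<in> ?J. ?K j \<subseteq> E}) = (\<Sum>r\<in>B. real (card (nbrs {..<n} E r \<inter> U)))"
      using fin by simp
    also have "\<dots> \<le> (\<Sum>r\<in>B. m)" using that by (intro sum_mono) auto
    finally show ?thesis by (simp add: t_def card_cartesian_product algebra_simps)
  qed
  then have "measure_pmf.prob (gnp n p) {E. \<forall>r\<in>B. real (card (nbrs {..<n} E r \<inter> U)) \<le> m}
     \<le> measure_pmf.prob (gnp n p) {E. real (card {j \<in> ?J. ?K j \<subseteq> E}) \<le> real (card ?J) * p ^ 1 - t}"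
    by (intro measure_pmf.finite_measure_mono) auto
  also have "\<dots> \<le> exp (- 2 * t\<^sup>2 / real (card ?J))"
  proof (rule gnp_disjoint_blocks(1))
    show "0 \<le> t" using m by (simp add: t_def)
    show "?K j \<subseteq> all_pairs n" if j: "j \<in> ?J" for j
    proof -
      obtain r u where "j = (r, u)" "r \<in> B" "u \<in> U" using j by blast
      moreover from this have "r \<noteq> u" using assms(3) by blast
      ultimately show ?thesis using assms(1,2) by (auto simp: all_pairs_def)
    qed
    show "disjoint_family_on ?K ?J"
      using assms(3) by (fastforce simp: disjoint_family_on_def doubleton_eq_iff)
  qed (use assms fin in auto)
  also have "- 2 * t\<^sup>2 / real (card ?J) = - 2 * real (card B) * (real (card U) * p - m)\<^sup>2 / real (card U)"
    using pos by (simp add: t_def card_cartesian_product power2_eq_square)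
  finally show ?thesis .
qed

lemma gnp_no_sparse_pair:
  assumes "0 \<le> p" "p \<le> 1" "0 < b" "0 < u" "1 \<le> n" and m: "m \<le> real u * p"
  shows "measure_pmf.prob (gnp n p) {E. \<exists>B U. B \<subseteq> {..<n} \<and> U \<subseteq> {..<n} \<and> B \<inter> U = {} \<and>
           card B = b \<and> card U = u \<and> (\<forall>r\<in>B. real (card (nbrs {..<n} E r \<inter> U)) \<le> m)}
         \<le> real n ^ (b + u) * exp (- 2 * real b * (real u * p - m)\<^sup>2 / real u)" (is "?P \<le> _ * ?q")
proof -
  let ?Bs = "{B. B \<subseteq> {..<n} \<and> card B = b}" and ?Us = "{U. U \<subseteq> {..<n} \<and> card U = u}"
  let ?I = "{(B, U) \<in> ?Bs \<times> ?Us. B \<inter> U = {}}"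
  let ?ev = "\<lambda>(B, U). {E. \<forall>r\<in>B. real (card (nbrs {..<n} E r \<inter> U)) \<le> m}"
  have sub: "?I \<subseteq> ?Bs \<times> ?Us" by auto
  have fin: "finite ?Bs" "finite ?Us" by (auto intro: finite_subset[of _ "Pow {..<n}"])
  then have finI: "finite ?I" using sub by (meson finite_SigmaI finite_subset)
  have "?P \<le> measure_pmf.prob (gnp n p) (\<Union>i\<in>?I. ?ev i)"
    by (intro measure_pmf.finite_measure_mono) auto
  also have "\<dots> \<le> (\<Sum>i\<in>?I. measure_pmf.prob (gnp n p) (?ev i))"
    using finI by (intro measure_pmf.finite_measure_subadditive_finite) auto
  also have "\<dots> \<le> (\<Sum>i\<in>?I. ?q)"
  proof (intro sum_mono)
    fix i assume "i \<in> ?I"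
    then obtain B U where i: "i = (B, U)" "B \<subseteq> {..<n}" "U \<subseteq> {..<n}" "B \<inter> U = {}" "card B = b" "card U = u"
      by auto
    then have "B \<noteq> {}" "U \<noteq> {}" using assms by auto
    with gnp_sparse_pair_tail[OF i(2-4) this assms(1,2)] m i
    show "measure_pmf.prob (gnp n p) (?ev i) \<le> ?q" by simp
  qed
  also have "\<dots> = real (card ?I) * ?q" by simp
  also have "\<dots> \<le> real (n ^ b * n ^ u) * ?q"
  proof -
    have le: "card {B. B \<subseteq> {..<n} \<and> card B = k} \<le> n ^ k" for k
      using binomial_le_pow[of k n] by (cases "k \<le> n") (simp_all add: n_subsets binomial_eq_0)
    have "card ?I \<le> card (?Bs \<times> ?Us)" using fin sub by (intro card_mono) auto
    also have "\<dots> \<le> n ^ b * n ^ u" unfolding card_cartesian_product using le by (intro mult_mono) auto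
    finally show ?thesis by (intro mult_right_mono) (auto simp del: of_nat_mult of_nat_power)
  qed
  finally show ?thesis by (simp add: power_add)
qed

section \<open>The damage number of the random graph\<close>

text \<open>Sets \<open>B\<close> and \<open>U\<close> in the sparse-pair estimate are disjoint and have prescribed sizes. A large
set of poor vertices gives such a pair: shrink it to \<open>B\<close> and remove \<open>B\<close> from the unvisited set,
which costs at most \<open>\<beta>\<close> of its \<open>\<beta> + u\<close> vertices.\<close>

lemma evasion_graphI:
  fixes \<beta> u n :: nat
  assumes "2 \<le> n" "0 < \<beta>"
    and "\<And>r. r < n \<Longrightarrow> m + real \<beta> \<le> real (card (nbrs {..<n} E r))"
    and "\<And>r c. r < n \<Longrightarrow> c < n \<Longrightarrow> r \<noteq> c \<Longrightarrow>
          real (card (nbrs {..<n} E r \<inter> insert c (nbrs {..<n} E c))) \<le> m"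
    and sparse: "\<nexists>B U. B \<subseteq> {..<n} \<and> U \<subseteq> {..<n} \<and> B \<inter> U = {} \<and> card B = \<beta> \<and> card U = u \<and>
          (\<forall>r\<in>B. real (card (nbrs {..<n} E r \<inter> U)) \<le> m)"
  shows "evasion_graph {..<n} E m \<beta> (\<beta> + u)"
proof
  fix U :: "nat set" assume U: "U \<subseteq> {..<n}" "\<beta> + u \<le> card U"
  let ?poor = "{r \<in> {..<n}. real (card (nbrs {..<n} E r \<inter> U)) \<le> m}"
  show "card ?poor < \<beta>"
  proof (rule ccontr)
    assume "\<not> ?thesis"
    then obtain B where B: "B \<subseteq> ?poor" "card B = \<beta>" "finite B"
      by (meson not_less obtain_subset_with_card_n)
    have "u \<le> card (U - B)"
      using diff_card_le_card_Diff[OF B(3), of U] U(2) B(2) by linarith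
    then obtain U' where U': "U' \<subseteq> U - B" "card U' = u"
      by (meson obtain_subset_with_card_n)
    have "real (card (nbrs {..<n} E r \<inter> U')) \<le> m" if "r \<in> B" for r
    proof -
      have "card (nbrs {..<n} E r \<inter> U') \<le> card (nbrs {..<n} E r \<inter> U)"
        using U U' by (intro card_mono) (auto intro: finite_subset)
      then show ?thesis using that B(1) by auto
    qed
    then show False using sparse B U' U(1) by blast
  qed
qed (use assms in auto)

text \<open>Here \<open>\<delta>\<close> is the relative precision. The guarded number is \<open>m = (1 + 2\<delta>) n p\<^sup>2\<close>, just above the
typical codegree, whereas a set of \<open>u = (1 + 4\<delta>) n p\<close> vertices contains about
\<open>u p = (1 + 4\<delta>) n p\<^sup>2\<close> neighbours of a typical vertex. The gap is a constant fraction of \<open>u p\<close>,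
so that \<open>\<beta> = \<delta> n p\<close> given vertices are all poor for given \<open>u\<close> others with probability at most
\<open>exp (- 2 \<delta>\<^sup>2 \<beta> u p\<^sup>2)\<close>, which beats the number \<open>n ^ (\<beta> + u)\<close> of pairs of sets. Finally
\<open>m + \<beta>\<close> stays below the minimum degree because \<open>p\<close> is bounded away from \<open>1\<close>. All exponents
in question are at least a multiple of \<open>n p\<^sup>4\<close>, and the hypothesis on \<open>n p\<^sup>4\<close> makes each of
the three kinds of failure have total probability at most \<open>1 / n\<close>.\<close>

lemma gnp_dmg_concentration:
  fixes n :: nat and p \<delta> :: real
  assumes \<delta>: "0 < \<delta>" "\<delta> \<le> 1 / 8" and p: "0 \<le> p" "p + 5 * \<delta> \<le> 1" and n: "3 \<le> n"
    and dense: "2 * ln (real n) \<le> \<delta> ^ 3 * (real n * p ^ 4)"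
  shows "1 - 3 / real n \<le> measure_pmf.prob (gnp n p)
           {E. (1 - \<delta>) * (real n * p) \<le> real n - real (dmg {..<n} E) \<and>
               real n - real (dmg {..<n} E) \<le> (1 + 6 * \<delta>) * (real n * p)}"
proof -
  have ln_n: "1 \<le> ln (real n)"
  proof -
    have "exp 1 \<le> real n" using exp_le n by linarith
    then show ?thesis using n by (subst ln_ge_iff) auto
  qed
  have p1: "p \<le> 1" "p < 1" using p \<delta> by auto
  have p0: "0 < p" using dense ln_n p(1) by (cases "p = 0") auto
  define x where "x = real n * p ^ 4"
  have pow: "p ^ 4 \<le> p ^ 3" "p ^ 3 \<le> p\<^sup>2" "p\<^sup>2 \<le> p"
    using p p1 power_decreasing[of 3 4 p] power_decreasing[of 2 3 p] power_decreasing[of 1 2 p] by auto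
  have x: "x \<le> real n * p ^ 3" "x \<le> real n * p\<^sup>2" "x \<le> real n * p" "x \<le> real n"
    unfolding x_def using pow p1 by (auto intro!: mult_left_mono mult_left_le)
  \<comment> \<open>As \<open>\<delta> \<le> 1 / 8\<close>, lowering the power of \<open>\<delta>\<close> in the density hypothesis gains constant factors.\<close>
  have "\<delta>\<^sup>2 \<le> 1 / 64" using power_mono[OF \<delta>(2), of 2] \<delta>(1) by (simp add: power_divide)
  then have "\<delta>\<^sup>2 * (\<delta> * x) \<le> 1 / 64 * (\<delta> * x)"
    using \<delta> p0 by (intro mult_right_mono) (auto simp: x_def)
  then have dx: "128 * ln (real n) \<le> \<delta> * x"
    using dense by (simp add: x_def power3_eq_cube power2_eq_square mult_ac)
  have "\<delta> * (\<delta>\<^sup>2 * x) \<le> 1 / 8 * (\<delta>\<^sup>2 * x)"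
    using \<delta> p0 by (intro mult_right_mono) (auto simp: x_def)
  then have ddx: "16 * ln (real n) \<le> \<delta>\<^sup>2 * x"
    using dense by (simp add: x_def power3_eq_cube power2_eq_square mult_ac)
  have np: "128 \<le> \<delta> * (real n * p)" "128 \<le> \<delta> * (real n * p\<^sup>2)" "128 \<le> \<delta> * real n"
    using dx ln_n x(2-4)[THEN mult_left_mono, of \<delta>] \<delta> by linarith+

  define m where "m = (1 + 2 * \<delta>) * (real n * p\<^sup>2)"
  define \<beta> where "\<beta> = nat \<lceil>\<delta> * (real n * p)\<rceil>"
  define u where "u = nat \<lceil>(1 + 4 * \<delta>) * (real n * p)\<rceil>"
  have \<beta>: "\<delta> * (real n * p) \<le> real \<beta>" "real \<beta> \<le> \<delta> * (real n * p) + 1"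
    unfolding \<beta>_def using np by linarith+
  have u_pos: "0 < (1 + 4 * \<delta>) * (real n * p)" using \<delta> p0 n by simp
  then have u: "(1 + 4 * \<delta>) * (real n * p) \<le> real u" "real u \<le> (1 + 4 * \<delta>) * (real n * p) + 1"
    unfolding u_def by linarith+
  have pos: "0 < \<beta>" "0 < u" using \<beta>(1) u(1) np(1) u_pos by linarith+

  define Low where "Low v = {E. real (card (nbrs {..<n} E v)) \<le> (real n - 1) * p - \<delta> / 2 * (real n * p)}" for v
  define High where "High = (\<lambda>(r, c). {E. real (card (nbrs {..<n} E r \<inter> insert c (nbrs {..<n} E c)))
      \<ge> real n * p\<^sup>2 + 2 + \<delta> * (real n * p\<^sup>2)})"
  define Sparse where "Sparse = {E. \<exists>B U. B \<subseteq> {..<n} \<and> U \<subseteq> {..<n} \<and> B \<inter> U = {} \<and>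
           card B = \<beta> \<and> card U = u \<and> (\<forall>r\<in>B. real (card (nbrs {..<n} E r \<inter> U)) \<le> m)}"
  define Pairs where "Pairs = {(r, c). r < n \<and> c < n \<and> r \<noteq> c}"
  define Bad where "Bad = (\<Union>v<n. Low v) \<union> (\<Union>i\<in>Pairs. High i) \<union> Sparse"
  let ?P = "measure_pmf.prob (gnp n p)"
  have exp_n: "exp (- real k * ln (real n)) = 1 / real n ^ k" for k
    using n by (simp add: exp_minus exp_of_nat_mult field_simps)

  have low: "?P (Low v) \<le> 1 / real n ^ 2" if "v < n" for v
  proof -
    have "?P (Low v) \<le> exp (- 2 * (\<delta> / 2 * (real n * p))\<^sup>2 / real n)"
      unfolding Low_def using that n p p1 \<delta> by (intro gnp_degree_tail) auto
    also have "- 2 * (\<delta> / 2 * (real n * p))\<^sup>2 / real n = - (\<delta>\<^sup>2 * (real n * p\<^sup>2) / 2)"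
      using n by (simp add: power2_eq_square)
    also have "exp \<dots> \<le> exp (- real 2 * ln (real n))"
      using ddx ln_n mult_left_mono[OF x(2), of "\<delta>\<^sup>2"] by (subst exp_le_cancel_iff) auto
    finally show ?thesis unfolding exp_n .
  qed
  have high: "?P (High i) \<le> 1 / real n ^ 3" if "i \<in> Pairs" for i
  proof -
    obtain r c where i: "i = (r, c)" "r < n" "c < n" "r \<noteq> c" using \<open>i \<in> Pairs\<close> by (auto simp: Pairs_def)
    have "?P (High i) \<le> exp (- 2 * (\<delta> * (real n * p\<^sup>2))\<^sup>2 / real n)"
      unfolding High_def i(1) prod.case using i n p p1 \<delta> by (intro gnp_codegree_tail) auto
    also have "- 2 * (\<delta> * (real n * p\<^sup>2))\<^sup>2 / real n = - (2 * (\<delta>\<^sup>2 * x))"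
      using n by (simp add: x_def power2_eq_square power4_eq_xxxx)
    also have "exp \<dots> \<le> exp (- real 3 * ln (real n))"
      using ddx ln_n by (subst exp_le_cancel_iff) auto
    finally show ?thesis unfolding exp_n .
  qed
  have gap: "\<delta> * (real u * p) \<le> real u * p - m"
  proof -
    have "m = (1 + 2 * \<delta>) * (real n * p) * p" by (simp add: m_def power2_eq_square)
    also have "(1 + 2 * \<delta>) * (real n * p) \<le> (1 - \<delta>) * ((1 + 4 * \<delta>) * (real n * p))"
    proof -
      have "1 + 2 * \<delta> \<le> (1 - \<delta>) * (1 + 4 * \<delta>)"
        using mult_left_mono[OF \<delta>(2), of \<delta>] \<delta> by (simp add: algebra_simps)
      then show ?thesis
        using p n by (metis mult.assoc mult_right_mono mult_nonneg_nonneg of_nat_0_le_iff)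
    qed
    also have "\<dots> \<le> (1 - \<delta>) * real u" using u(1) \<delta> by (intro mult_left_mono) auto
    finally show ?thesis using p by (simp add: algebra_simps mult_right_mono)
  qed
  have sparse: "?P Sparse \<le> 1 / real n"
  proof -
    have "0 \<le> \<delta> * (real u * p)" using \<delta> p by auto
    then have "m \<le> real u * p" using gap by linarith
    then have "?P Sparse \<le> real n ^ (\<beta> + u) * exp (- 2 * real \<beta> * (real u * p - m)\<^sup>2 / real u)"
      unfolding Sparse_def using p p1 pos n by (intro gnp_no_sparse_pair) auto
    also have "- 2 * real \<beta> * (real u * p - m)\<^sup>2 / real u \<le> - real (\<beta> + u + 1) * ln (real n)"
    proof -
      have "(\<delta> * (real u * p))\<^sup>2 \<le> (real u * p - m)\<^sup>2"
        using gap \<open>0 \<le> \<delta> * (real u * p)\<close> by (rule power_mono)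
      then have "2 * real \<beta> * (\<delta> * (real u * p))\<^sup>2 / real u \<le> 2 * real \<beta> * (real u * p - m)\<^sup>2 / real u"
        by (intro divide_right_mono mult_left_mono) auto
      moreover have "2 * real \<beta> * (\<delta> * (real u * p))\<^sup>2 / real u = real u * (2 * (\<delta>\<^sup>2 * p\<^sup>2 * real \<beta>))"
        using pos by (simp add: power2_eq_square)
      moreover have "3 * ln (real n) \<le> 2 * (\<delta>\<^sup>2 * p\<^sup>2 * real \<beta>)"
      proof -
        have "\<delta> ^ 3 * x \<le> \<delta> ^ 3 * (real n * p ^ 3)" using x \<delta> by (intro mult_left_mono) auto
        also have "\<dots> = \<delta>\<^sup>2 * p\<^sup>2 * (\<delta> * (real n * p))" by (simp add: power2_eq_square power3_eq_cube)
        also have "\<dots> \<le> \<delta>\<^sup>2 * p\<^sup>2 * real \<beta>" using \<beta> by (intro mult_left_mono) auto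
        finally show ?thesis using dense ln_n unfolding x_def by linarith
      qed
      moreover have "real (\<beta> + u + 1) * ln (real n) \<le> real u * (3 * ln (real n))"
      proof -
        have "\<delta> * (real n * p) + 1 \<le> (1 + 4 * \<delta>) * (real n * p)"
        proof -
          have "real n * p \<ge> 1" using np(1) \<delta> mult_right_mono[OF \<delta>(2), of "real n * p"] p by auto
          moreover have "0 \<le> \<delta> * (real n * p)" using np by linarith
          ultimately show ?thesis by (simp add: algebra_simps)
        qed
        then have "real \<beta> \<le> real u" using \<beta> u by linarith
        then have "real (\<beta> + u + 1) \<le> real u * 3" using pos by auto
        then show ?thesis using mult_right_mono[of "real (\<beta> + u + 1)" "real u * 3" "ln (real n)"] ln_n
          by (simp add: mult.assoc)
      qed
      moreover have "real u * (3 * ln (real n)) \<le> real u * (2 * (\<delta>\<^sup>2 * p\<^sup>2 * real \<beta>))"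
        using calculation(3) by (intro mult_left_mono) auto
      ultimately show ?thesis by linarith
    qed
    also have "real n ^ (\<beta> + u) * exp (- real (\<beta> + u + 1) * ln (real n)) = 1 / real n"
      unfolding exp_n using n by simp
    finally show ?thesis by (simp add: mult_left_mono)
  qed

  have "?P Bad \<le> (\<Sum>v<n. ?P (Low v)) + (\<Sum>i\<in>Pairs. ?P (High i)) + ?P Sparse"
  proof -
    have fin: "finite Pairs" unfolding Pairs_def
      by (rule finite_subset[of _ "{..<n} \<times> {..<n}"]) auto
    have "?P (\<Union>v<n. Low v) \<le> (\<Sum>v<n. ?P (Low v))"
      by (intro measure_pmf.finite_measure_subadditive_finite) auto
    moreover have "?P (\<Union>i\<in>Pairs. High i) \<le> (\<Sum>i\<in>Pairs. ?P (High i))"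
      using fin by (intro measure_pmf.finite_measure_subadditive_finite) auto
    moreover have "?P Bad \<le> ?P ((\<Union>v<n. Low v) \<union> (\<Union>i\<in>Pairs. High i)) + ?P Sparse"
      unfolding Bad_def by (intro measure_Un_le) auto
    moreover have "?P ((\<Union>v<n. Low v) \<union> (\<Union>i\<in>Pairs. High i))
        \<le> ?P (\<Union>v<n. Low v) + ?P (\<Union>i\<in>Pairs. High i)"
      by (intro measure_Un_le) auto
    ultimately show ?thesis by linarith
  qed
  also have "(\<Sum>v<n. ?P (Low v)) \<le> (\<Sum>v<n. 1 / real n ^ 2)" using low by (intro sum_mono) auto
  also have "(\<Sum>v<n. 1 / real n ^ 2) = 1 / real n" by (simp add: power2_eq_square)
  also have "(\<Sum>i\<in>Pairs. ?P (High i)) \<le> (\<Sum>i\<in>Pairs. 1 / real n ^ 3)" using high by (intro sum_mono) auto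
  also have "\<dots> \<le> 1 / real n"
  proof -
    have "card Pairs \<le> card ({..<n} \<times> {..<n})" by (intro card_mono) (auto simp: Pairs_def)
    then have "real (card Pairs) \<le> real n * real n"
      by (metis card_cartesian_product card_lessThan of_nat_le_iff of_nat_mult)
    then have "real (card Pairs) * (1 / real n ^ 3) \<le> real n * real n * (1 / real n ^ 3)"
      by (intro mult_right_mono) auto
    also have "\<dots> = 1 / real n" using n by (simp add: power3_eq_cube)
    finally show ?thesis by simp
  qed
  also note sparse
  finally have bad: "?P Bad \<le> 3 / real n" by simp

  have good: "(1 - \<delta>) * (real n * p) \<le> real n - real (dmg {..<n} E) \<and>
      real n - real (dmg {..<n} E) \<le> (1 + 6 * \<delta>) * (real n * p)" if E: "E \<notin> Bad" for E
  proof -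
    have deg: "(1 - \<delta>) * (real n * p) \<le> real (card (nbrs {..<n} E v))" if "v < n" for v
    proof -
      have "(real n - 1) * p - \<delta> / 2 * (real n * p) < real (card (nbrs {..<n} E v))"
        using E that by (auto simp: Bad_def Low_def not_le)
      then show ?thesis using np(1) p1 by (simp add: algebra_simps)
    qed
    have "evasion_graph {..<n} E m \<beta> (\<beta> + u)"
    proof (rule evasion_graphI)
      fix r assume r: "r < n"
      have "\<delta> * p \<le> \<delta>" using p1 \<delta> by (simp add: mult_left_le)
      moreover have "(1 + 2 * \<delta>) * p = p + 2 * (\<delta> * p)" by (simp add: algebra_simps)
      ultimately have "(1 + 2 * \<delta>) * p + 2 * \<delta> \<le> 1 - \<delta>"
        using p by linarith
      then have "((1 + 2 * \<delta>) * p + 2 * \<delta>) * (real n * p) \<le> (1 - \<delta>) * (real n * p)"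
        using p by (intro mult_right_mono) auto
      then have "m + 2 * (\<delta> * (real n * p)) \<le> (1 - \<delta>) * (real n * p)"
        by (simp add: m_def power2_eq_square algebra_simps)
      then show "m + real \<beta> \<le> real (card (nbrs {..<n} E r))"
        using deg[OF r] \<beta>(2) np(1) by linarith
    next
      fix r c assume "r < n" "c < n" "r \<noteq> c"
      then have "(r, c) \<in> Pairs" by (simp add: Pairs_def)
      then have "E \<notin> High (r, c)" using E by (auto simp: Bad_def)
      then have "real (card (nbrs {..<n} E r \<inter> insert c (nbrs {..<n} E c)))
          < real n * p\<^sup>2 + 2 + \<delta> * (real n * p\<^sup>2)"
        by (simp add: High_def)
      moreover have "m = real n * p\<^sup>2 + 2 * (\<delta> * (real n * p\<^sup>2))" by (simp add: m_def algebra_simps)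
      ultimately show "real (card (nbrs {..<n} E r \<inter> insert c (nbrs {..<n} E c))) \<le> m"
        using np(2) by linarith
    next
      show "\<nexists>B U. B \<subseteq> {..<n} \<and> U \<subseteq> {..<n} \<and> B \<inter> U = {} \<and> card B = \<beta> \<and> card U = u \<and>
          (\<forall>r\<in>B. real (card (nbrs {..<n} E r \<inter> U)) \<le> m)"
        using E by (auto simp: Bad_def Sparse_def)
    qed (use n pos in auto)
    then have "card {..<n} \<le> dmg {..<n} E + (\<beta> + u)" by (rule evasion_graph.card_le_dmg_add)
    then have "real n - real (dmg {..<n} E) \<le> real \<beta> + real u"
      unfolding card_lessThan by linarith
    also have "\<dots> \<le> (1 + 6 * \<delta>) * (real n * p)"
      using \<beta>(2) u(2) np(1) by (simp add: algebra_simps)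
    finally have upper: "real n - real (dmg {..<n} E) \<le> (1 + 6 * \<delta>) * (real n * p)" .
    have "dmg {..<n} E \<le> card {..<n} - card (nbrs {..<n} E 0)"
      using n by (intro dmg_le_card_minus_degree) auto
    moreover have "card (nbrs {..<n} E 0) \<le> card {..<n}" by (intro card_mono nbrs_subset) auto
    ultimately have "real (dmg {..<n} E) \<le> real n - real (card (nbrs {..<n} E 0))"
      unfolding card_lessThan by linarith
    then show ?thesis using upper deg[of 0] n by auto
  qed
  have "1 - 3 / real n \<le> 1 - ?P Bad" using bad by simp
  also have "\<dots> = ?P (- Bad)" using measure_pmf.prob_compl[of Bad "gnp n p"] by (simp add: Compl_eq_Diff_UNIV)
  also have "\<dots> \<le> ?P {E. (1 - \<delta>) * (real n * p) \<le> real n - real (dmg {..<n} E) \<and>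
               real n - real (dmg {..<n} E) \<le> (1 + 6 * \<delta>) * (real n * p)}"
    using good by (intro measure_pmf.finite_measure_mono) auto
  finally show ?thesis .
qed

text \<open>The event \<open>Q\<close> is a parameter because both parts of the final result weaken the two bounds,
each in its own way.\<close>

lemma whp_dmg_concentration:
  assumes \<delta>: "0 < \<delta>" "\<delta> \<le> 1 / 8"
    and p: "\<forall>\<^sub>F n in sequentially. 0 \<le> p n \<and> p n + 5 * \<delta> \<le> 1"
    and dense: "\<forall>\<^sub>F n in sequentially. 2 * ln (real n) \<le> \<delta> ^ 3 * (real n * p n ^ 4)"
    and imp: "\<And>n E. 0 \<le> real n * p n \<Longrightarrow> (1 - \<delta>) * (real n * p n) \<le> real n - real (dmg {..<n} E) \<Longrightarrow>
        real n - real (dmg {..<n} E) \<le> (1 + 6 * \<delta>) * (real n * p n) \<Longrightarrow> Q n E"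
  shows "whp (\<lambda>n. gnp n (p n)) Q"
  unfolding whp_def
proof (rule tendsto_sandwich)
  show "\<forall>\<^sub>F n in sequentially. 1 - 3 / real n \<le> measure_pmf.prob (gnp n (p n)) {E. Q n E}"
    using p dense eventually_ge_at_top[of 3]
  proof eventually_elim
    case (elim n)
    have "1 - 3 / real n \<le> measure_pmf.prob (gnp n (p n))
           {E. (1 - \<delta>) * (real n * p n) \<le> real n - real (dmg {..<n} E) \<and>
               real n - real (dmg {..<n} E) \<le> (1 + 6 * \<delta>) * (real n * p n)}"
      using elim \<delta> by (intro gnp_dmg_concentration) auto
    also have "\<dots> \<le> measure_pmf.prob (gnp n (p n)) {E. Q n E}"
      using imp[of n] elim by (intro measure_pmf.finite_measure_mono) auto
    finally show ?case .
  qed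
  show "(\<lambda>n. 1 - 3 / real n) \<longlonglongrightarrow> 1" by real_asymp
qed auto

theorem theorem1p5:
  "(\<forall>p::real. 0 < p \<and> p < 1 \<longrightarrow>
      (\<forall>\<epsilon>::real. \<epsilon> > 0 \<longrightarrow>
        whp (\<lambda>n. gnp n p)
          (\<lambda>n E. (1 - \<epsilon>) * p * real n \<le> real n - real (dmg {..<n} E) \<and>
                 real n - real (dmg {..<n} E) \<le> (1 + \<epsilon>) * p * real n)))
   \<and>
   (\<forall>p::nat \<Rightarrow> real. (\<forall>n. 0 \<le> p n \<and> p n \<le> 1) \<and>
        (\<lambda>n. ln (real n) powr (2/5) / real n powr (1/5)) \<in> o(p) \<and>
        p \<in> o(\<lambda>_. 1) \<longrightarrow>
      (\<exists>c C::real. 0 < c \<and> c < C \<and>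
        whp (\<lambda>n. gnp n (p n))
          (\<lambda>n E. c * (real n * p n) \<le> real n - real (dmg {..<n} E) \<and>
                 real n - real (dmg {..<n} E) \<le> C * (real n * p n))))"
proof (intro conjI allI impI)
  fix p \<epsilon> :: real
  assume p: "0 < p \<and> p < 1" and \<epsilon>: "\<epsilon> > 0"
  define \<delta> where "\<delta> = min (1 / 8) (min (\<epsilon> / 6) ((1 - p) / 5))"
  have "0 < \<delta>" unfolding \<delta>_def using p \<epsilon> by simp
  moreover have "\<delta> \<le> 1 / 8" unfolding \<delta>_def by linarith
  moreover have "\<delta> \<le> \<epsilon> / 6" unfolding \<delta>_def by linarith
  moreover have "\<delta> \<le> (1 - p) / 5" unfolding \<delta>_def by linarith
  ultimately have \<delta>: "0 < \<delta>" "\<delta> \<le> 1 / 8" "6 * \<delta> \<le> \<epsilon>" "p + 5 * \<delta> \<le> 1"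
    by (simp_all add: field_simps)
  show "whp (\<lambda>n. gnp n p)
          (\<lambda>n E. (1 - \<epsilon>) * p * real n \<le> real n - real (dmg {..<n} E) \<and>
                 real n - real (dmg {..<n} E) \<le> (1 + \<epsilon>) * p * real n)"
  proof (rule whp_dmg_concentration[where p = "\<lambda>_. p", OF \<delta>(1,2)])
    \<comment> \<open>For constant \<open>p\<close> the quantity \<open>n p\<^sup>4\<close> is linear in \<open>n\<close>.\<close>
    have "0 < \<delta> ^ 3 * p ^ 4" using \<delta> p by simp
    then have "\<forall>\<^sub>F n in sequentially. 2 * ln (real n) \<le> (\<delta> ^ 3 * p ^ 4) * real n" by real_asymp
    then show "\<forall>\<^sub>F n in sequentially. 2 * ln (real n) \<le> \<delta> ^ 3 * (real n * p ^ 4)"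
      by (simp add: mult_ac)
    fix n :: nat and E
    assume *: "0 \<le> real n * p" "(1 - \<delta>) * (real n * p) \<le> real n - real (dmg {..<n} E)"
      "real n - real (dmg {..<n} E) \<le> (1 + 6 * \<delta>) * (real n * p)"
    have "(1 - \<epsilon>) * (real n * p) \<le> (1 - \<delta>) * (real n * p)"
      "(1 + 6 * \<delta>) * (real n * p) \<le> (1 + \<epsilon>) * (real n * p)"
      using * \<delta> by (auto intro!: mult_right_mono)
    then show "(1 - \<epsilon>) * p * real n \<le> real n - real (dmg {..<n} E) \<and>
                 real n - real (dmg {..<n} E) \<le> (1 + \<epsilon>) * p * real n"
      using * by (simp add: mult_ac)
  qed (use p \<delta> in auto)
next
  fix p :: "nat \<Rightarrow> real"
  assume p: "(\<forall>n. 0 \<le> p n \<and> p n \<le> 1) \<and>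
        (\<lambda>n. ln (real n) powr (2/5) / real n powr (1/5)) \<in> o(p) \<and> p \<in> o(\<lambda>_. 1)"
  have "whp (\<lambda>n. gnp n (p n))
          (\<lambda>n E. 7 / 8 * (real n * p n) \<le> real n - real (dmg {..<n} E) \<and>
                 real n - real (dmg {..<n} E) \<le> 7 / 4 * (real n * p n))"
  proof (rule whp_dmg_concentration[where \<delta> = "1 / 8"])
    have "\<forall>\<^sub>F n in sequentially. \<bar>p n\<bar> \<le> 3 / 8"
      using landau_o.smallD[of p _ "\<lambda>_. 1" "3 / 8"] p by simp
    then show "\<forall>\<^sub>F n in sequentially. 0 \<le> p n \<and> p n + 5 * (1 / 8) \<le> 1"
      by eventually_elim (use p in auto)
    let ?x = "\<lambda>n. ln (real n) powr (2/5) / real n powr (1/5)"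
    have "\<forall>\<^sub>F n in sequentially. \<bar>?x n\<bar> \<le> 1 * \<bar>p n\<bar>"
      using landau_o.smallD[of ?x _ p 1] p by simp
    \<comment> \<open>At the lower end of the range \<open>n p\<^sup>4\<close> is \<open>n powr (1/5) * ln n powr (8/5)\<close>.\<close>
    moreover have "\<forall>\<^sub>F n in sequentially. 2 * ln (real n) \<le> (1 / 8) ^ 3 * (real n * ?x n ^ 4)"
      by real_asymp
    ultimately show "\<forall>\<^sub>F n in sequentially. 2 * ln (real n) \<le> (1 / 8) ^ 3 * (real n * p n ^ 4)"
    proof eventually_elim
      case (elim n)
      have "?x n ^ 4 \<le> p n ^ 4" using elim(1) p by (intro power_mono) auto
      then have "(1 / 8) ^ 3 * (real n * ?x n ^ 4) \<le> (1 / 8) ^ 3 * (real n * p n ^ 4)"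
        by (intro mult_left_mono) auto
      then show ?case using elim(2) by linarith
    qed
  qed auto
  then show "\<exists>c C::real. 0 < c \<and> c < C \<and>
        whp (\<lambda>n. gnp n (p n))
          (\<lambda>n E. c * (real n * p n) \<le> real n - real (dmg {..<n} E) \<and>
                 real n - real (dmg {..<n} E) \<le> C * (real n * p n))"
    by (intro exI[of _ "7 / 8"] exI[of _ "7 / 4"]) auto
qed

end
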